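(* Let $k,t$ be integers with $t\ge 1$ and $k\ge t+1$. Let $M=(m_{i,j})_{i,j\ge 1}$ be the infinite lower triangular matrix (so $m_{i,j}=0$ for $j>i$) such that, for every $i\ge 1$, the first-column entry $m_{i,1}$ is the number (total weight) of $(k-t-1,t)$-Motzkin paths of length $i-1$, and such that for all $i\ge 2$ and $j\ge 2$ $$m_{i,j}=m_{i-1,j-1}+(k-t-1)\,m_{i-1,j}+t\,m_{i-1,j+1}.$$ Then $$M\begin{bmatrix}1\\ 1+t\\ 1+t+t^2\\ \vdots\end{bmatrix}=\begin{bmatrix}1\\ k\\ k^2\\ \vdots\end{bmatrix},$$ that is, $\sum_{j=1}^{i} m_{i,j}\,(1+t+\cdots+t^{j-1})=k^{i-1}$ for every $i\ge 1$.
   Context: A Motzkin path of length $n$ is a lattice path from $(0,0)$ to $(n,0)$ with up steps $U=(1,1)$, down steps $D=(1,-1)$ and horizontal steps $H=(1,0)$ that never goes below the $x$-axis. An $(a,b)$-Motzkin path is a Motzkin path in which each horizontal step has weight $a$, each down step has weight $b$ and each up step has weight $1$. The weight of a path is the product of the weights of its steps (the empty path has weight $1$), and the number of $(a,b)$-Motzkin paths of length $n$ means the sum of the weights of all such paths. Thus $m_{1,1}=1$. *)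

theory Defs
  imports Main "HOL-Library.Product_Plus"
begin

datatype step = U | D | H

fun step_vec :: "step \<Rightarrow> int \<times> int" where
  "step_vec U = (1, 1)"
| "step_vec D = (1, -1)"
| "step_vec H = (1, 0)"

text \<open>The lattice point reached from the origin after the given steps.\<close>
definition endpoint :: "step list \<Rightarrow> int \<times> int" where
  "endpoint p = sum_list (map step_vec p)"

text \<open>A path is its list of steps. It stays weakly above the x-axis iff all its
  vertices do, and the vertices are the endpoints of its prefixes.\<close>
definition motzkin_paths :: "nat \<Rightarrow> step list set" where
  "motzkin_paths n =
    {p. endpoint p = (int n, 0) \<and> (\<forall>i\<le>length p. 0 \<le> snd (endpoint (take i p)))}"

fun step_weight :: "'a::comm_semiring_1 \<Rightarrow> 'a \<Rightarrow> step \<Rightarrow> 'a" where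
  "step_weight a b U = 1"
| "step_weight a b D = b"
| "step_weight a b H = a"

definition path_weight :: "'a::comm_semiring_1 \<Rightarrow> 'a \<Rightarrow> step list \<Rightarrow> 'a" where
  "path_weight a b p = prod_list (map (step_weight a b) p)"

definition motzkin_number :: "'a::comm_semiring_1 \<Rightarrow> 'a \<Rightarrow> nat \<Rightarrow> 'a" where
  "motzkin_number a b n = (\<Sum>p\<in>motzkin_paths n. path_weight a b p)"

lemma fst_endpoint: "fst (endpoint p) = int (length p)"
proof (induction p)
  case Nil
  then show ?case by (simp add: endpoint_def)
next
  case (Cons s p)
  then show ?case by (cases s) (simp_all add: endpoint_def)
qed

lemma length_motzkin_path: "p \<in> motzkin_paths n \<Longrightarrow> length p = n"
  using fst_endpoint[of p] by (simp add: motzkin_paths_def)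

text \<open>The sum defining \<open>motzkin_number\<close> is therefore a genuine finite sum.\<close>
lemma finite_motzkin_paths: "finite (motzkin_paths n)"
proof (rule finite_subset)
  have "x \<in> {U, D, H}" for x by (cases x) auto
  then show "motzkin_paths n \<subseteq> {p. set p \<subseteq> {U, D, H} \<and> length p = n}"
    by (auto simp only: length_motzkin_path)
  show "finite {p. set p \<subseteq> {U, D, H} \<and> length p = n}"
    by (rule finite_lists_length_eq) simp
qed

end

theory Submission
  imports Defs
begin

text \<open>Let $a = k - t - 1$. Removing the last step shows that the weighted number of Motzkin
  prefixes of length $n$ ending at height $h$ obeys the recurrence of $M$ in \<^emph>\<open>every\<close> column,
  the first one included; hence this number is $m_{n+1,h+1}$. The vector with entries
  $c_j = 1 + t + \cdots + t^{j-1}$ satisfies $c_0 = 0$ and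
  $c_{j+1} + a c_j + t c_{j-1} = k c_j$, so it is an eigenvector of the transfer operator with
  eigenvalue $k$, and each row sum is $k$ times the preceding one.\<close>

text \<open>Heights are integers so that \<open>h - 1\<close> at \<open>h = 0\<close> is a genuine
  negative height, reached by no prefix; one recurrence then serves all
  \<open>h \<ge> 0\<close>.\<close>

definition motzkin_prefixes :: "nat \<Rightarrow> int \<Rightarrow> step list set" where
  "motzkin_prefixes n h =
    {p. endpoint p = (int n, h) \<and> (\<forall>i\<le>length p. 0 \<le> snd (endpoint (take i p)))}"

definition motzkin_prefix_number :: "'a::comm_semiring_1 \<Rightarrow> 'a \<Rightarrow> nat \<Rightarrow> int \<Rightarrow> 'a" where
  "motzkin_prefix_number a b n h = (\<Sum>p\<in>motzkin_prefixes n h. path_weight a b p)"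

lemma motzkin_number_eq_prefix_number:
  "motzkin_number a b n = motzkin_prefix_number a b n 0"
  by (simp add: motzkin_number_def motzkin_prefix_number_def motzkin_paths_def motzkin_prefixes_def)

lemma endpoint_Nil: "endpoint [] = (0, 0)"
  by (simp add: endpoint_def zero_prod_def)

lemma endpoint_snoc: "endpoint (p @ [s]) = endpoint p + step_vec s"
  by (simp add: endpoint_def)

lemma length_motzkin_prefix: "p \<in> motzkin_prefixes n h \<Longrightarrow> length p = n"
  using fst_endpoint[of p] by (simp add: motzkin_prefixes_def)

lemma finite_motzkin_prefixes: "finite (motzkin_prefixes n h)"
proof (rule finite_subset)
  have "x \<in> {U, D, H}" for x by (cases x) auto
  then show "motzkin_prefixes n h \<subseteq> {p. set p \<subseteq> {U, D, H} \<and> length p = n}"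
    by (auto simp only: length_motzkin_prefix)
  show "finite {p. set p \<subseteq> {U, D, H} \<and> length p = n}"
    by (rule finite_lists_length_eq) simp
qed

lemma motzkin_prefixes_0: "motzkin_prefixes 0 h = (if h = 0 then {[]} else {})"
proof -
  have "p \<in> motzkin_prefixes 0 h \<longleftrightarrow> p = [] \<and> h = 0" for p
    using length_motzkin_prefix[of p 0 h] by (auto simp: motzkin_prefixes_def endpoint_Nil)
  then show ?thesis by auto
qed

lemma motzkin_prefixes_neg: "h < 0 \<Longrightarrow> motzkin_prefixes n h = {}"
  by (force simp: motzkin_prefixes_def)

text \<open>Appending \<open>s\<close> creates just one new vertex, the endpoint at height
  \<open>h\<close>, and the assumption on \<open>h\<close> puts that vertex above or on the
  axis.\<close>

lemma snoc_in_motzkin_prefixes_iff: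
  assumes "h \<ge> 0"
  shows "p @ [s] \<in> motzkin_prefixes (Suc n) h \<longleftrightarrow>
    p \<in> motzkin_prefixes n (h - snd (step_vec s))"
proof -
  have "endpoint (p @ [s]) = (int (Suc n), h) \<longleftrightarrow>
      endpoint p = (int n, h - snd (step_vec s))"
    by (cases s) (auto simp: endpoint_snoc prod_eq_iff)
  moreover have "(\<forall>i\<le>length (p @ [s]). 0 \<le> snd (endpoint (take i (p @ [s])))) \<longleftrightarrow>
      (\<forall>i\<le>length p. 0 \<le> snd (endpoint (take i p))) \<and> 0 \<le> snd (endpoint (p @ [s]))"
    by (auto simp: le_Suc_eq)
  ultimately show ?thesis
    using assms by (auto simp: motzkin_prefixes_def)
qed

lemma motzkin_prefixes_Suc:
  assumes "h \<ge> 0"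
  shows "motzkin_prefixes (Suc n) h = (\<lambda>p. p @ [U]) ` motzkin_prefixes n (h - 1) \<union>
    ((\<lambda>p. p @ [H]) ` motzkin_prefixes n h \<union> (\<lambda>p. p @ [D]) ` motzkin_prefixes n (h + 1))"
    (is "_ = ?R")
proof (intro set_eqI)
  fix q
  show "q \<in> motzkin_prefixes (Suc n) h \<longleftrightarrow> q \<in> ?R"
  proof (cases q rule: rev_cases)
    case Nil
    then show ?thesis by (auto dest: length_motzkin_prefix)
  next
    case (snoc p s)
    then show ?thesis
      by (cases s) (auto simp: snoc_in_motzkin_prefixes_iff[OF assms])
  qed
qed

lemma path_weight_snoc: "path_weight a b (p @ [s]) = path_weight a b p * step_weight a b s"
  by (simp add: path_weight_def)

lemma sum_path_weight_snoc:
  "(\<Sum>q\<in>(\<lambda>p. p @ [s]) ` P. path_weight a b q) = step_weight a b s * (\<Sum>p\<in>P. path_weight a b p)"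
  by (subst sum.reindex) (auto simp: inj_on_def path_weight_snoc sum_distrib_left mult.commute)

lemma motzkin_prefix_number_0:
  "motzkin_prefix_number a b 0 h = (if h = 0 then 1 else 0)"
  by (simp add: motzkin_prefix_number_def motzkin_prefixes_0 path_weight_def)

lemma motzkin_prefix_number_neg: "h < 0 \<Longrightarrow> motzkin_prefix_number a b n h = 0"
  by (simp add: motzkin_prefix_number_def motzkin_prefixes_neg)

lemma motzkin_prefix_number_Suc:
  assumes "h \<ge> 0"
  shows "motzkin_prefix_number a b (Suc n) h = motzkin_prefix_number a b n (h - 1)
    + a * motzkin_prefix_number a b n h + b * motzkin_prefix_number a b n (h + 1)"
proof -
  have "motzkin_prefix_number a b (Suc n) h =
      (\<Sum>q\<in>(\<lambda>p. p @ [U]) ` motzkin_prefixes n (h - 1). path_weight a b q) +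
      ((\<Sum>q\<in>(\<lambda>p. p @ [H]) ` motzkin_prefixes n h. path_weight a b q) +
       (\<Sum>q\<in>(\<lambda>p. p @ [D]) ` motzkin_prefixes n (h + 1). path_weight a b q))"
    \<comment> \<open>The three images are disjoint because their words end in different
      steps.\<close>
    unfolding motzkin_prefix_number_def motzkin_prefixes_Suc[OF assms]
    by (subst sum.union_disjoint; (subst sum.union_disjoint)?)
      (auto simp: finite_motzkin_prefixes)
  then show ?thesis
    by (simp add: sum_path_weight_snoc motzkin_prefix_number_def add.assoc)
qed

text \<open>The last two summands are the boundary terms of truncating the summation by parts at \<open>N\<close>.\<close>
lemma sum_tridiagonal_step:
  fixes v w c :: "nat \<Rightarrow> 'a::comm_ring_1"
  assumes "c 0 = 0"
    and "v 0 = a * w 0 + b * w 1"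
    and "\<And>h. v (Suc h) = w h + a * w (Suc h) + b * w (Suc (Suc h))"
  shows "(\<Sum>h\<le>N. v h * c (Suc h)) =
    (\<Sum>h\<le>N. w h * (c (Suc (Suc h)) + a * c (Suc h) + b * c h))
    - w N * c (Suc (Suc N)) + b * w (Suc N) * c (Suc N)"
  by (induction N) (simp_all add: assms algebra_simps)

text \<open>With \<open>S\<close> the sum over \<open>l < h\<close>, both sides equal
  \<open>(1 + t) * (S + t ^ h)\<close>. Adding \<open>k - t - 1\<close> times the sum over
  \<open>l < Suc h\<close> turns the factor \<open>1 + t\<close> into the eigenvalue
  \<open>k\<close>.\<close>

lemma geometric_sum_eigen:
  fixes t :: "'a::comm_ring_1"
  shows "(\<Sum>l<Suc (Suc h). t ^ l) + t * (\<Sum>l<h. t ^ l) = (1 + t) * (\<Sum>l<Suc h. t ^ l)"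
  by (simp add: algebra_simps)

theorem theorem4p1:
  fixes k t :: int and m :: "nat \<Rightarrow> nat \<Rightarrow> int"
  assumes "t \<ge> 1" and "k \<ge> t + 1"
    and lower_triangular: "\<And>i j. i \<ge> 1 \<Longrightarrow> j \<ge> 1 \<Longrightarrow> j > i \<Longrightarrow> m i j = 0"
    and first_column: "\<And>i. i \<ge> 1 \<Longrightarrow> m i 1 = motzkin_number (k - t - 1) t (i - 1)"
    and recurrence: "\<And>i j. i \<ge> 2 \<Longrightarrow> j \<ge> 2 \<Longrightarrow>
      m i j = m (i - 1) (j - 1) + (k - t - 1) * m (i - 1) j + t * m (i - 1) (j + 1)"
  shows "\<forall>i\<ge>1. (\<Sum>j=1..i. m i j * (\<Sum>l<j. t ^ l)) = k ^ (i - 1)"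
proof -
  define a where "a = k - t - 1"
  define c where "c j = (\<Sum>l<j. t ^ l)" for j
  have rec: "m (Suc (Suc n)) (Suc (Suc h)) =
      m (Suc n) (Suc h) + a * m (Suc n) (Suc (Suc h)) + t * m (Suc n) (Suc (Suc (Suc h)))" for n h
    using recurrence[of "Suc (Suc n)" "Suc (Suc h)"] by (simp add: a_def)
  have m_eq: "m (Suc n) (Suc h) = motzkin_prefix_number a t n (int h)" for n h
  proof (induction n arbitrary: h)
    case 0
    then show ?case
      using first_column[of 1] lower_triangular[of 1 "Suc h"]
      by (cases h) (simp_all add: motzkin_number_eq_prefix_number motzkin_prefix_number_0)
  next
    case (Suc n)
    show ?case
    \<comment> \<open>The assumed recurrence starts at column 2, so column 1 is read off from
      \<open>first_column\<close> instead.\<close>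
    proof (cases h)
      case 0
      then show ?thesis
        using first_column[of "Suc (Suc n)"] by (simp add: motzkin_number_eq_prefix_number a_def)
    next
      case (Suc h')
      then show ?thesis
        by (simp add: rec Suc.IH motzkin_prefix_number_Suc add.commute)
    qed
  qed
  \<comment> \<open>In column 1 the recurrence is a consequence of the path count: the term at
    height \<open>-1\<close> vanishes.\<close>
  have rec0: "m (Suc (Suc n)) (Suc 0) = a * m (Suc n) (Suc 0) + t * m (Suc n) (Suc 1)" for n
    by (simp add: m_eq motzkin_prefix_number_Suc motzkin_prefix_number_neg)
  have eigen: "c (Suc (Suc h)) + a * c (Suc h) + t * c h = k * c (Suc h)" for h
    using geometric_sum_eigen[of t h] by (simp add: c_def a_def algebra_simps)
  have row: "(\<Sum>h\<le>n. m (Suc n) (Suc h) * c (Suc h)) = k ^ n" for n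
  proof (induction n)
    case 0
    then show ?case by (simp add: m_eq motzkin_prefix_number_0 c_def)
  next
    case (Suc n)
    \<comment> \<open>Truncating at \<open>N = Suc n\<close> makes both boundary terms vanish: they
      involve columns \<open>n + 2\<close> and \<open>n + 3\<close> of row \<open>n + 1\<close>,
      which lie above the diagonal.\<close>
    have "(\<Sum>h\<le>Suc n. m (Suc (Suc n)) (Suc h) * c (Suc h)) =
        (\<Sum>h\<le>Suc n. m (Suc n) (Suc h) * (c (Suc (Suc h)) + a * c (Suc h) + t * c h))"
      by (subst sum_tridiagonal_step[where a = a and b = t and w = "\<lambda>h. m (Suc n) (Suc h)"])
        (simp_all add: rec rec0 c_def lower_triangular)
    \<comment> \<open>The summand for \<open>h = Suc n\<close> drops out, again by
      triangularity.\<close>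
    also have "\<dots> = k * (\<Sum>h\<le>n. m (Suc n) (Suc h) * c (Suc h))"
      by (simp add: eigen lower_triangular sum_distrib_left mult.left_commute)
    finally show ?case by (simp add: Suc.IH)
  qed
  show ?thesis
  proof (intro allI impI)
    fix i :: nat
    assume "i \<ge> 1"
    then obtain n where i: "i = Suc n" by (cases i) auto
    have "(\<Sum>j=1..i. m i j * (\<Sum>l<j. t ^ l)) = (\<Sum>h\<le>n. m (Suc n) (Suc h) * c (Suc h))"
      unfolding i c_def One_nat_def
      by (simp only: sum.shift_bounds_cl_Suc_ivl atLeast0AtMost)
    then show "(\<Sum>j=1..i. m i j * (\<Sum>l<j. t ^ l)) = k ^ (i - 1)"
      by (simp add: row i)
  qed
qed

end
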